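(* Let $\Lambda_0>0$, $\alpha\in(0,1)$, $\gamma>0$, $\beta\in(0,1]$, and let $\lambda(t)=\mathcal{L}^{-1}\{\tilde\lambda(s)\}(t)$ be the inverse Laplace transform of $$\tilde\lambda(s)=\frac{\Lambda_0}{s}\,\frac{\gamma+s^{\beta}}{(1-\alpha)\gamma+s^{\beta}}.$$ Then $$\lim_{t\to\infty}\lambda(t)=\frac{\Lambda_0}{1-\alpha}.$$
   Context: The Laplace transform of a function $f$ on $[0,\infty)$ is $\mathcal{L}\{f\}(s)=\int_0^\infty e^{-st}f(t)\,dt$. The inverse Laplace transform $\mathcal{L}^{-1}\{\tilde\lambda\}$ denotes the continuous function on $[0,\infty)$ whose Laplace transform equals $\tilde\lambda(s)$ for all sufficiently large real $s$. *)

theory Defs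
  imports "HOL-Analysis.Analysis"
begin

text \<open>For integrands continuous on \<open>[0,\<infinity>)\<close> the gauge integral over \<open>{0..}\<close> is the
  improper Riemann integral, so conditional convergence is allowed.\<close>

definition laplace_transform :: "(real \<Rightarrow> real) \<Rightarrow> real \<Rightarrow> real" where
  "laplace_transform f s = integral {0..} (\<lambda>t. exp (- s * t) * f t)"

definition laplace_converges :: "(real \<Rightarrow> real) \<Rightarrow> real \<Rightarrow> bool" where
  "laplace_converges f s \<longleftrightarrow> (\<lambda>t. exp (- s * t) * f t) integrable_on {0..}"

text \<open>A function on \<open>[0,\<infinity>)\<close> is represented by its extension by zero to the negative
  reals; without this normalisation the description below could not be unique.\<close>

definition inverse_laplace :: "(real \<Rightarrow> real) \<Rightarrow> real \<Rightarrow> real" where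
  "inverse_laplace F = (THE f.
     continuous_on {0..} f \<and> (\<forall>t<0. f t = 0) \<and>
     (\<forall>\<^sub>F s in at_top. laplace_converges f s \<and> laplace_transform f s = F s))"

end

theory Submission
  imports Defs "HOL-Complex_Analysis.Complex_Analysis" "HOL-Real_Asymp.Real_Asymp"
begin

text \<open>Put \<open>c = (1 - \<alpha>) \<gamma>\<close>. By partial fractions the inverse transform is
  \<open>\<lambda>(t) = \<Lambda>0 / (1 - \<alpha>) * (1 - \<alpha> g(t))\<close>, where \<open>g\<close> is the Mittag-Leffler relaxation function
  with transform \<open>s powr (\<beta> - 1) / (s powr \<beta> + c)\<close>. For \<open>\<beta> < 1\<close> the function \<open>g\<close> is
  written as a mixture \<open>\<integral> k(x) exp (- exp(x) t) dx\<close> of decaying exponentials with an integrable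
  density \<open>k \<ge> 0\<close>, so that \<open>g(t) \<longlongrightarrow> 0\<close> by dominated convergence; its transform
  \<open>\<integral> k(x) / (exp(x) + s) dx\<close> is computed by the residue theorem on the rectangles
  \<open>[-R,R] \<times> [-\<pi>,\<pi>]\<close>. Uniqueness of the inverse transform is Lerch's theorem.\<close>

subsection \<open>Lerch's theorem\<close>

text \<open>A gauge integral over the whole line is approximated on every box containing a large
  ball, in particular on symmetric intervals. This needs no absolute convergence, and it later
  matches the truncation to rectangles of width \<open>2 * R\<close>.\<close>

lemma has_integral_UNIV_imp_tendsto:
  fixes f :: "real \<Rightarrow> 'a::banach"
  assumes "(f has_integral I) UNIV"
  shows "((\<lambda>R. integral {-R..R} f) \<longlongrightarrow> I) at_top"
proof (rule tendstoI)
  fix e :: real assume "e > 0"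
  then obtain B where "B > 0" and B: "\<And>a b. ball 0 B \<subseteq> cbox a b \<Longrightarrow> norm (integral (cbox a b) f - I) < e"
    using assms unfolding has_integral_alt'[of f I UNIV] by auto
  have "norm (integral {-R..R} f - I) < e" if "R \<ge> B" for R
  proof -
    have "ball 0 B \<subseteq> cbox (-R) R"
      using that by (auto simp: dist_real_def)
    from B[OF this] show ?thesis by simp
  qed
  then show "\<forall>\<^sub>F R in at_top. dist (integral {-R..R} f) I < e"
    unfolding eventually_at_top_linorder dist_norm by blast
qed

lemma has_integral_atLeast_imp_tendsto:
  fixes f :: "real \<Rightarrow> 'a::banach"
  assumes "(f has_integral I) {0..}"
  shows "((\<lambda>T. integral {0..T} f) \<longlongrightarrow> I) at_top"
proof -
  have "((\<lambda>t. if t \<in> {0..} then f t else 0) has_integral I) UNIV"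
    using assms by (simp only: has_integral_restrict_UNIV)
  from has_integral_UNIV_imp_tendsto[OF this]
  have "((\<lambda>T. integral ({0..} \<inter> {-T..T}) f) \<longlongrightarrow> I) at_top"
    by (simp only: Henstock_Kurzweil_Integration.integral_restrict_Int)
  moreover have "{0..} \<inter> {-T..T} = {0..T}" for T :: real
    by auto
  ultimately show ?thesis by (simp only:)
qed

text \<open>Under \<open>x = exp (- t)\<close> the hypothesis says that all moments of a continuous function on
  \<open>[0,1]\<close> vanish, so the Weierstrass approximation theorem applies. Integrating over \<open>[0,T]\<close>
  avoids the change of variables.\<close>

lemma continuous_zero_if_exp_moments_tendsto_zero:
  fixes h :: "real \<Rightarrow> real"
  assumes cont: "continuous_on {0..} h"
    and lim: "(h \<longlongrightarrow> 0) at_top"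
    and moments: "\<And>n. ((\<lambda>T. integral {0..T} (\<lambda>t. exp (- real (Suc n) * t) * h t)) \<longlongrightarrow> 0) at_top"
    and "t \<ge> 0"
  shows "h t = 0"
proof -
  \<comment> \<open>\<open>H\<close> is \<open>h\<close> in the variable
    \<open>x = exp (- t)\<close>. The value 0 at \<open>x = 0\<close> is the limit of
    \<open>h\<close> at infinity, which makes \<open>H\<close> continuous on the compact
    interval.\<close>
  define H where "H x = (if x = 0 then 0 else h (- ln x))" for x
  have contH: "continuous_on {0..1} H"
    unfolding continuous_on_eq_continuous_within
  proof
    fix x :: real assume x: "x \<in> {0..1}"
    show "continuous (at x within {0..1}) H"
    proof (cases "x = 0")
      case True
      have "filterlim (\<lambda>x::real. - ln x) at_top (at_right 0)"
        by real_asymp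
      then have "((\<lambda>x. h (- ln x)) \<longlongrightarrow> 0) (at_right 0)"
        by (rule filterlim_compose[OF lim])
      moreover have "\<forall>\<^sub>F x in at_right 0. H x = h (- ln x)"
        by (auto simp: H_def eventually_at_filter)
      ultimately have "(H \<longlongrightarrow> 0) (at_right 0)"
        by (simp add: filterlim_cong)
      then have "(H \<longlongrightarrow> 0) (at 0 within {0..1})"
        by (simp add: at_within_Icc_at_right)
      then show ?thesis
        by (simp add: True continuous_within H_def)
    next
      case False
      have "continuous_on {0<..1} (\<lambda>x::real. h (- ln x))"
        by (rule continuous_on_compose2[OF cont]) (auto intro!: continuous_intros)
      then have "continuous_on {0<..1} H"
        by (rule continuous_on_eq) (auto simp: H_def)
      then have "continuous (at x within {0<..1}) H"
        using x False by (auto simp: continuous_on_eq_continuous_within)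
      moreover have "at x within {0<..1} = at x within {0..1}"
        by (rule at_within_nhd[of _ "{0<..}"]) (use x False in auto)
      ultimately show ?thesis
        by (simp add: continuous_within)
    qed
  qed
  have H_exp: "H (exp (- t)) = h t" for t
    by (simp add: H_def)
  have cont': "continuous_on {0..T} h" for T
    using cont by (rule continuous_on_subset) auto
  obtain M where M: "\<And>t. t \<ge> 0 \<Longrightarrow> \<bar>h t\<bar> \<le> M"
  proof -
    have "bounded (H ` {0..1})"
      by (intro compact_imp_bounded compact_continuous_image contH) auto
    then obtain M where "\<And>x. x \<in> {0..1} \<Longrightarrow> \<bar>H x\<bar> \<le> M"
      unfolding bounded_iff by fastforce
    then have "\<bar>h t\<bar> \<le> M" if "t \<ge> 0" for t
      using that H_exp[of t] by (metis atLeastAtMost_iff exp_ge_zero exp_le_one_iff neg_le_0_iff_le)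
    then show ?thesis using that by blast
  qed
  have "M \<ge> 0" using M[of 0] by simp
  \<comment> \<open>The factor \<open>exp (- t)\<close> is the Jacobian of
    \<open>x = exp (- t)\<close>. It turns the power \<open>x ^ i\<close> into the exponent
    \<open>Suc i\<close>, so only the moments of positive order occur.\<close>
  have poly: "((\<lambda>T. integral {0..T} (\<lambda>t. exp (- t) * p (exp (- t)) * h t)) \<longlongrightarrow> 0) at_top"
    if "real_polynomial_function p" for p
  proof -
    obtain a n where p: "p = (\<lambda>x. \<Sum>i\<le>n. a i * x ^ i)"
      using \<open>real_polynomial_function p\<close> unfolding real_polynomial_function_iff_sum by blast
    have "exp (- t) * p (exp (- t)) * h t = (\<Sum>i\<le>n. a i * (exp (- real (Suc i) * t) * h t))" for t
      unfolding p sum_distrib_left sum_distrib_right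
      by (intro sum.cong) (auto simp: exp_of_nat_mult[symmetric] exp_add[symmetric] algebra_simps)
    moreover have "integral {0..T} (\<lambda>t. \<Sum>i\<le>n. a i * (exp (- real (Suc i) * t) * h t)) =
        (\<Sum>i\<le>n. a i * integral {0..T} (\<lambda>t. exp (- real (Suc i) * t) * h t))" for T
      by (subst integral_sum) (auto intro!: integrable_continuous_interval continuous_intros cont')
    moreover have "((\<lambda>T. \<Sum>i\<le>n. a i * integral {0..T} (\<lambda>t. exp (- real (Suc i) * t) * h t))
        \<longlongrightarrow> (\<Sum>i\<le>n. a i * 0)) at_top"
      by (intro tendsto_intros moments)
    ultimately show ?thesis by simp
  qed
  have int_exp: "integral {0..T} (\<lambda>t. exp (- t)) \<le> 1" if "T \<ge> 0" for T :: real
  proof -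
    have "((\<lambda>t. exp (- t)) has_integral (- exp (- T) - (- exp (- 0)))) {0..T}"
      using that by (intro fundamental_theorem_of_calculus)
        (auto intro!: derivative_eq_intros simp flip: has_real_derivative_iff_has_vector_derivative)
    then show ?thesis by (simp add: integral_unique)
  qed
  have sq: "integral {0..T} (\<lambda>t. exp (- t) * (h t)\<^sup>2) = 0" if "T \<ge> 0" for T
  proof -
    have "integral {0..T} (\<lambda>t. exp (- t) * (h t)\<^sup>2) \<le> 0 + e" if "e > 0" for e
    proof -
      \<comment> \<open>The weight \<open>exp (- t)\<close> has mass at most 1 and \<open>h\<close>
        is bounded by \<open>M\<close>, so uniform error \<open>d\<close> costs at most
        \<open>d * M\<close>. Dividing by \<open>M + 1\<close> covers \<open>M = 0\<close>.\<close>
      define d where "d = e / (M + 1)"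
      have "d > 0" and dM: "d * M \<le> e"
        using \<open>e > 0\<close> \<open>M \<ge> 0\<close> by (auto simp: d_def field_simps)
      obtain p where p: "real_polynomial_function p" and pH: "\<And>x. x \<in> {0..1} \<Longrightarrow> \<bar>H x - p x\<bar> < d"
        using Stone_Weierstrass_real_polynomial_function[OF _ contH \<open>d > 0\<close>] by auto
      have contp: "continuous_on S p" for S
        using p by (simp add: continuous_on_polymonial_function real_polynomial_function_eq)
      have contpe: "continuous_on S (\<lambda>t. p (exp (- t)))" for S :: "real set"
        by (rule continuous_on_compose2[OF contp[of UNIV]]) (auto intro!: continuous_intros)
      \<comment> \<open>The polynomial integrals vanish only in the limit. With \<open>T\<close>
        fixed, the nonnegative square may be integrated over the longer interval up to
        \<open>U\<close>, and then \<open>U\<close> goes to infinity.\<close>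
      have upper: "integral {0..T} (\<lambda>t. exp (- t) * (h t)\<^sup>2)
          \<le> integral {0..U} (\<lambda>t. exp (- t) * p (exp (- t)) * h t) + e" if "U \<ge> T" for U
      proof -
        have "U \<ge> 0" using \<open>T \<ge> 0\<close> that by simp
        have "integral {0..T} (\<lambda>t. exp (- t) * (h t)\<^sup>2) \<le> integral {0..U} (\<lambda>t. exp (- t) * (h t)\<^sup>2)"
          using that by (intro integral_subset_le)
            (auto intro!: integrable_continuous_interval continuous_intros cont')
        also have "\<dots> \<le> integral {0..U} (\<lambda>t. exp (- t) * p (exp (- t)) * h t + e * exp (- t))"
        proof (intro integral_le)
          fix t assume t: "t \<in> {0..U}"
          have "(h t - p (exp (- t))) * h t \<le> \<bar>h t - p (exp (- t))\<bar> * \<bar>h t\<bar>"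
            by (metis abs_ge_self abs_mult)
          also have "\<dots> \<le> d * M"
            using t pH[of "exp (- t)"] M[of t] \<open>d > 0\<close>
            by (intro mult_mono) (auto simp: H_exp)
          finally have "(h t - p (exp (- t))) * h t \<le> e" using dM by simp
          then have "exp (- t) * ((h t - p (exp (- t))) * h t) \<le> exp (- t) * e"
            by (intro mult_left_mono) auto
          then show "exp (- t) * (h t)\<^sup>2 \<le> exp (- t) * p (exp (- t)) * h t + e * exp (- t)"
            by (simp add: algebra_simps power2_eq_square)
        qed (auto intro!: integrable_continuous_interval continuous_intros cont' contpe)
        also have "\<dots> = integral {0..U} (\<lambda>t. exp (- t) * p (exp (- t)) * h t)
            + e * integral {0..U} (\<lambda>t. exp (- t))"
          by (subst Henstock_Kurzweil_Integration.integral_add)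
            (auto intro!: integrable_continuous_interval continuous_intros cont' contpe)
        also have "\<dots> \<le> integral {0..U} (\<lambda>t. exp (- t) * p (exp (- t)) * h t) + e"
          using int_exp[OF \<open>U \<ge> 0\<close>] \<open>e > 0\<close> by simp
        finally show ?thesis .
      qed
      have "((\<lambda>U. integral {0..U} (\<lambda>t. exp (- t) * p (exp (- t)) * h t) + e) \<longlongrightarrow> 0 + e) at_top"
        by (intro tendsto_intros poly p)
      then show ?thesis
        by (rule tendsto_lowerbound) (use upper in \<open>auto simp: eventually_at_top_linorder\<close>)
    qed
    then have "integral {0..T} (\<lambda>t. exp (- t) * (h t)\<^sup>2) \<le> 0"
      by (rule field_le_epsilon)
    moreover have "integral {0..T} (\<lambda>t. exp (- t) * (h t)\<^sup>2) \<ge> 0"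
      by (intro Henstock_Kurzweil_Integration.integral_nonneg)
        (auto intro!: integrable_continuous_interval continuous_intros cont')
    ultimately show ?thesis by simp
  qed
  have "exp (- t) * (h t)\<^sup>2 = 0"
  \<comment> \<open>A continuous nonnegative function with integral 0 vanishes; the endpoint
    \<open>t + 1\<close> keeps the interval nondegenerate when \<open>t = 0\<close>.\<close>
  proof (rule has_integral_0_cbox_imp_0[of 0 "t + 1" "\<lambda>t. exp (- t) * (h t)\<^sup>2"])
    show "continuous_on (cbox 0 (t + 1)) (\<lambda>t. exp (- t) * (h t)\<^sup>2)"
      by (auto intro!: continuous_intros cont')
    then have "(\<lambda>t. exp (- t) * (h t)\<^sup>2) integrable_on cbox 0 (t + 1)"
      by (rule integrable_continuous)
    then show "((\<lambda>t. exp (- t) * (h t)\<^sup>2) has_integral 0) (cbox 0 (t + 1))"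
      using sq[of "t + 1"] \<open>t \<ge> 0\<close> by (simp add: has_integral_iff)
  qed (use \<open>t \<ge> 0\<close> in auto)
  then show ?thesis by simp
qed

text \<open>The transform may converge only conditionally, so one integrates by parts and works with the
  bounded primitive of \<open>exp (- s0 t) f t\<close> instead of \<open>f\<close>.\<close>

lemma laplace_zero_imp_zero:
  fixes f :: "real \<Rightarrow> real"
  assumes cont: "continuous_on {0..} f"
    and zero: "\<forall>\<^sub>F s in at_top. ((\<lambda>t. exp (- s * t) * f t) has_integral 0) {0..}"
    and "t \<ge> 0"
  shows "f t = 0"
proof -
  obtain s0 where s0: "\<And>s. s \<ge> s0 \<Longrightarrow> ((\<lambda>t. exp (- s * t) * f t) has_integral 0) {0..}"
    using zero by (auto simp: eventually_at_top_linorder)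
  define k where "k t = exp (- s0 * t) * f t" for t
  define h where "h t = integral {0..t} k" for t
  have contk: "continuous_on {0..T} k" for T
    unfolding k_def by (intro continuous_intros continuous_on_subset[OF cont]) auto
  have deriv: "(h has_real_derivative k t) (at t within {0..T})" if "t \<in> {0..T}" for t T
    unfolding h_def by (rule integral_has_real_derivative[OF contk that])
  have conth': "continuous_on {0..T} h" for T
    using deriv by (meson DERIV_continuous continuous_on_eq_continuous_within)
  have conth: "continuous_on {0..} h"
    unfolding continuous_on_eq_continuous_within
  proof
    fix x :: real assume "x \<in> {0..}"
    then have "continuous (at x within {0..x + 1}) h"
      using conth'[of "x + 1"] by (auto simp: continuous_on_eq_continuous_within)
    moreover have "at x within {0..x + 1} = at x within {0..}"
      by (rule at_within_nhd[of _ "{..<x + 1}"]) auto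
    ultimately show "continuous (at x within {0..}) h"
      by (simp add: continuous_within)
  qed
  \<comment> \<open>The limit of the primitive at infinity is the transform at \<open>s0\<close>,
    which is zero.\<close>
  have limh: "(h \<longlongrightarrow> 0) at_top"
    unfolding h_def k_def by (rule has_integral_atLeast_imp_tendsto[OF s0]) simp
  have "((\<lambda>T. integral {0..T} (\<lambda>t. exp (- real (Suc n) * t) * h t)) \<longlongrightarrow> 0) at_top" for n
  proof -
    define q where "q = real (Suc n)"
    have "q > 0" by (simp add: q_def)
    \<comment> \<open>Integration by parts expresses the moment of \<open>h\<close> of order
      \<open>q\<close> through the transform of \<open>f\<close> at \<open>s0 + q\<close>, where it
      also vanishes. The lower boundary term drops out because \<open>h 0 = 0\<close>.\<close>
    have eq: "integral {0..T} (\<lambda>t. exp (- q * t) * h t) =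
        (integral {0..T} (\<lambda>t. exp (- (s0 + q) * t) * f t) - exp (- q * T) * h T) / q" if "T \<ge> 0" for T
    proof -
      have "((\<lambda>t. exp (- q * t) * k t - q * (exp (- q * t) * h t)) has_integral
          (exp (- q * T) * h T - exp (- q * 0) * h 0)) {0..T}"
        using that by (intro fundamental_theorem_of_calculus)
          (auto intro!: derivative_eq_intros deriv
            simp flip: has_real_derivative_iff_has_vector_derivative)
      moreover have "h 0 = 0" by (simp add: h_def)
      ultimately have "integral {0..T} (\<lambda>t. exp (- q * t) * k t - q * (exp (- q * t) * h t)) =
          exp (- q * T) * h T"
        by (simp add: integral_unique)
      moreover have "integral {0..T} (\<lambda>t. exp (- q * t) * k t - q * (exp (- q * t) * h t)) =
          integral {0..T} (\<lambda>t. exp (- q * t) * k t) - q * integral {0..T} (\<lambda>t. exp (- q * t) * h t)"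
        by (subst Henstock_Kurzweil_Integration.integral_diff)
          (auto intro!: integrable_continuous_interval continuous_intros contk conth')
      moreover have "exp (- q * t) * k t = exp (- (s0 + q) * t) * f t" for t
        by (simp add: k_def exp_add[symmetric] algebra_simps)
      ultimately show ?thesis
        using \<open>q > 0\<close> by (simp add: field_simps)
    qed
    have "((\<lambda>T. integral {0..T} (\<lambda>t. exp (- (s0 + q) * t) * f t)) \<longlongrightarrow> 0) at_top"
      by (rule has_integral_atLeast_imp_tendsto[OF s0]) (use \<open>q > 0\<close> in simp)
    moreover have "((\<lambda>T. exp (- q * T) * h T) \<longlongrightarrow> 0 * 0) at_top"
    proof (intro tendsto_mult limh)
      show "((\<lambda>T. exp (- q * T)) \<longlongrightarrow> 0) at_top"
        using \<open>q > 0\<close> by real_asymp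
    qed
    ultimately have "((\<lambda>T. (integral {0..T} (\<lambda>t. exp (- (s0 + q) * t) * f t) - exp (- q * T) * h T) / q)
        \<longlongrightarrow> (0 - 0 * 0) / q) at_top"
      using \<open>q > 0\<close> by (intro tendsto_divide tendsto_diff tendsto_const) auto
    moreover have "\<forall>\<^sub>F T in at_top. (integral {0..T} (\<lambda>t. exp (- (s0 + q) * t) * f t) - exp (- q * T) * h T) / q
        = integral {0..T} (\<lambda>t. exp (- q * t) * h t)"
      using eventually_ge_at_top[of 0] by eventually_elim (simp only: eq)
    ultimately show ?thesis
      unfolding q_def[symmetric] by (simp add: filterlim_cong)
  qed
  then have h0: "h t = 0" if "t \<ge> 0" for t
    using continuous_zero_if_exp_moments_tendsto_zero[OF conth limh] that by blast
  \<comment> \<open>\<open>h\<close> has the derivatives \<open>k t\<close> and 0 at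
    \<open>t\<close>; uniqueness within the interval also covers the one-sided case
    \<open>t = 0\<close>.\<close>
  have "(h has_real_derivative k t) (at t within {0..t + 1})"
    using deriv \<open>t \<ge> 0\<close> by simp
  moreover have "(h has_real_derivative 0) (at t within {0..t + 1})"
    using \<open>t \<ge> 0\<close> by (intro has_field_derivative_transform_within[OF DERIV_const[of 0], of 1]) (auto simp: h0)
  ultimately have "k t = 0"
    using \<open>t \<ge> 0\<close> vector_derivative_unique_within_closed_interval[of 0 "t + 1" t h "k t" 0]
    by (simp add: has_real_derivative_iff_has_vector_derivative)
  then show ?thesis by (simp add: k_def)
qed

text \<open>The difference of two candidates has transform zero for all large \<open>s\<close>, so
  they agree on the half-line; on the negative reals both are zero by normalisation. This resolves
  the definite description.\<close>

lemma inverse_laplace_eqI: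
  assumes "continuous_on {0..} f" and "\<And>t. t < 0 \<Longrightarrow> f t = 0"
    and "\<forall>\<^sub>F s in at_top. ((\<lambda>t. exp (- s * t) * f t) has_integral F s) {0..}"
  shows "inverse_laplace F = f"
  unfolding inverse_laplace_def
proof (rule the_equality)
  show "continuous_on {0..} f \<and> (\<forall>t<0. f t = 0) \<and>
      (\<forall>\<^sub>F s in at_top. laplace_converges f s \<and> laplace_transform f s = F s)"
    using assms by (auto simp: laplace_converges_def laplace_transform_def has_integral_iff elim!: eventually_mono)
next
  fix g assume g: "continuous_on {0..} g \<and> (\<forall>t<0. g t = 0) \<and>
      (\<forall>\<^sub>F s in at_top. laplace_converges g s \<and> laplace_transform g s = F s)"
  then have "\<forall>\<^sub>F s in at_top. ((\<lambda>t. exp (- s * t) * g t) has_integral F s) {0..}"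
    by (auto simp: laplace_converges_def laplace_transform_def has_integral_iff elim!: eventually_mono)
  with assms(3) have "\<forall>\<^sub>F s in at_top. ((\<lambda>t. exp (- s * t) * (g t - f t)) has_integral 0) {0..}"
  proof eventually_elim
    case (elim s)
    from has_integral_diff[OF this(2,1)] show ?case by (simp add: algebra_simps)
  qed
  then have "g t - f t = 0" if "t \<ge> 0" for t
    using g assms that by (intro laplace_zero_imp_zero[of "\<lambda>t. g t - f t"]) (auto intro!: continuous_intros)
  then show "g = f"
    using g assms(2) by (metis eq_iff_diff_eq_0 ext linorder_not_less)
qed

subsection \<open>A Stieltjes transform\<close>

lemma contour_integral_linepath_same_Im:
  assumes "a < b"
  shows "contour_integral (linepath (Complex a y) (Complex b y)) f = integral {a..b} (\<lambda>x. f (Complex x y))"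
proof -
  have "linepath (Complex a y) (Complex b y) = (+) (\<i> * y) \<circ> linepath (of_real a) (of_real b)"
    by (auto simp: linepath_def fun_eq_iff complex_eq_iff algebra_simps)
  moreover have "Complex x y = of_real x + \<i> * y" for x
    by (simp add: complex_eq_iff)
  ultimately show ?thesis
    using contour_integral_linepath_Reals_eq[of "of_real a" "of_real b" "\<lambda>x. f (x + \<i> * y)"] assms
    by (simp add: contour_integral_translate)
qed

text \<open>The top and left sides are traversed backwards, whence the two minus signs. Vertical
  sides stay contour integrals, since they will only be estimated.\<close>

lemma contour_integral_rectpath:
  assumes "continuous_on (path_image (rectpath (Complex a c) (Complex b d))) f" "a < b" "c < d"
  shows "contour_integral (rectpath (Complex a c) (Complex b d)) f =
    integral {a..b} (\<lambda>x. f (Complex x c)) - integral {a..b} (\<lambda>x. f (Complex x d)) +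
    (contour_integral (linepath (Complex b c) (Complex b d)) f -
     contour_integral (linepath (Complex a c) (Complex a d)) f)"
proof -
  let ?A = "Complex a c" and ?B = "Complex b c" and ?C = "Complex b d" and ?D = "Complex a d"
  have rect: "rectpath ?A ?C = linepath ?A ?B +++ linepath ?B ?C +++ linepath ?C ?D +++ linepath ?D ?A"
    by (simp add: rectpath_def Let_def)
  have cont: "continuous_on (closed_segment ?A ?B) f" "continuous_on (closed_segment ?B ?C) f"
    "continuous_on (closed_segment ?C ?D) f" "continuous_on (closed_segment ?D ?A) f"
    using assms(1) by (auto simp: rect path_image_join intro: continuous_on_subset)
  then have "f contour_integrable_on linepath ?A ?B" "f contour_integrable_on linepath ?B ?C"
    "f contour_integrable_on linepath ?C ?D" "f contour_integrable_on linepath ?D ?A"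
    by (auto intro: contour_integrable_continuous_linepath)
  then have "contour_integral (rectpath ?A ?C) f = contour_integral (linepath ?A ?B) f +
      (contour_integral (linepath ?B ?C) f + (contour_integral (linepath ?C ?D) f +
       contour_integral (linepath ?D ?A) f))"
    by (simp add: rect contour_integral_join contour_integrable_joinI)
  moreover have "contour_integral (linepath ?C ?D) f = - contour_integral (linepath ?D ?C) f"
    using cont by (intro contour_integral_reverse_linepath) auto
  moreover have "contour_integral (linepath ?D ?A) f = - contour_integral (linepath ?A ?D) f"
    using cont by (intro contour_integral_reverse_linepath) auto
  ultimately show ?thesis
    using assms by (simp add: contour_integral_linepath_same_Im)
qed

text \<open>With \<open>G w = exp (\<beta> w) / (exp (\<beta> w) + c)\<close> this is \<open>Im (G (x + \<i> \<pi>)) / \<pi>\<close>, the boundary jump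
  of \<open>z powr \<beta> / (z powr \<beta> + c)\<close> across the negative axis in the coordinate \<open>z = exp w\<close>.\<close>

definition stieltjes_density :: "real \<Rightarrow> real \<Rightarrow> real \<Rightarrow> real" where
  "stieltjes_density \<beta> c x = c * sin (\<beta> * pi) * exp (\<beta> * x) /
     (pi * ((exp (\<beta> * x) + c * cos (\<beta> * pi))\<^sup>2 + (c * sin (\<beta> * pi))\<^sup>2))"

context
  fixes \<beta> c :: real
  assumes \<beta>: "0 < \<beta>" "\<beta> < 1" and c: "0 < c"
begin

text \<open>Here \<open>\<beta> < 1\<close> must be strict: at \<open>\<beta> = 1\<close> the sine
  is zero and the density degenerates, so that case is treated separately below.\<close>

lemma sin_beta_pi_pos: "sin (\<beta> * pi) > 0"
  using \<beta> by (intro sin_gt_zero) auto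

lemma stieltjes_density_nonneg: "stieltjes_density \<beta> c x \<ge> 0"
  using sin_beta_pi_pos c by (auto simp: stieltjes_density_def)

lemma stieltjes_density_denom_pos: "(exp (\<beta> * x) + c * cos (\<beta> * pi))\<^sup>2 + (c * sin (\<beta> * pi))\<^sup>2 > 0"
  using sin_beta_pi_pos c by (intro add_nonneg_pos) auto

lemma isCont_stieltjes_density: "isCont (stieltjes_density \<beta> c) x"
  unfolding stieltjes_density_def
  using stieltjes_density_denom_pos[of x] by (intro continuous_intros) auto

text \<open>A nonnegative function whose primitive has finite limits at both ends is
  integrable.\<close>

lemma stieltjes_density_integrable: "integrable lborel (stieltjes_density \<beta> c)"
proof -
  define S where "S = c * sin (\<beta> * pi)"
  define C where "C = c * cos (\<beta> * pi)"
  \<comment> \<open>The substitution \<open>u = exp (\<beta> * x)\<close> turns the density into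
    \<open>S / (pi * \<beta> * ((u + C)\<^sup>2 + S\<^sup>2))\<close>, with an arctangent as
    primitive.\<close>
  define A where "A x = arctan ((exp (\<beta> * x) + C) / S) / (pi * \<beta>)" for x
  have S: "S > 0"
    using sin_beta_pi_pos c by (simp add: S_def)
  have "DERIV A x :> stieltjes_density \<beta> c x" for x
  proof -
    have "(A has_real_derivative (\<beta> * exp (\<beta> * x) / S / (1 + ((exp (\<beta> * x) + C) / S)\<^sup>2)) / (pi * \<beta>)) (at x)"
      unfolding A_def using S by (intro DERIV_cdivide) (auto intro!: derivative_eq_intros simp: field_simps)
    moreover have "(exp (\<beta> * x) + C)\<^sup>2 + S\<^sup>2 > 0"
      using S by (intro add_nonneg_pos) auto
    then have "(\<beta> * exp (\<beta> * x) / S / (1 + ((exp (\<beta> * x) + C) / S)\<^sup>2)) / (pi * \<beta>) = stieltjes_density \<beta> c x"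
      using S \<beta> unfolding stieltjes_density_def S_def[symmetric] C_def[symmetric]
      by (simp add: power_divide add_divide_distrib[symmetric] add_frac_eq divide_simps)
        (simp add: power2_eq_square algebra_simps)
    ultimately show ?thesis by simp
  qed
  moreover have "((A \<circ> real_of_ereal) \<longlongrightarrow> arctan (C / S) / (pi * \<beta>)) (at_right (-\<infinity>))"
    unfolding ereal_tendsto_simps A_def[abs_def]
  proof -
    have "((\<lambda>x. exp (\<beta> * x)) \<longlongrightarrow> 0) at_bot"
      using \<beta> by real_asymp
    then have "((\<lambda>x. arctan ((exp (\<beta> * x) + C) / S) / (pi * \<beta>)) \<longlongrightarrow> arctan ((0 + C) / S) / (pi * \<beta>)) at_bot"
      using S \<beta> by (intro tendsto_intros) auto
    then show "((\<lambda>x. arctan ((exp (\<beta> * x) + C) / S) / (pi * \<beta>)) \<longlongrightarrow> arctan (C / S) / (pi * \<beta>)) at_bot"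
      by simp
  qed
  moreover have "((A \<circ> real_of_ereal) \<longlongrightarrow> (pi / 2) / (pi * \<beta>)) (at_left \<infinity>)"
    unfolding ereal_tendsto_simps A_def[abs_def]
  proof -
    have "filterlim (\<lambda>x. (exp (\<beta> * x) + C) / S) at_top at_top"
      using \<beta> S by real_asymp
    then have "((\<lambda>x. arctan ((exp (\<beta> * x) + C) / S)) \<longlongrightarrow> pi / 2) at_top"
      by (rule filterlim_compose[OF tendsto_arctan_at_top])
    then show "((\<lambda>x. arctan ((exp (\<beta> * x) + C) / S) / (pi * \<beta>)) \<longlongrightarrow> (pi / 2) / (pi * \<beta>)) at_top"
      using \<beta> by (intro tendsto_intros) auto
  qed
  ultimately have "set_integrable lborel (einterval (-\<infinity>) \<infinity>) (stieltjes_density \<beta> c)"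
    by (intro interval_integral_FTC_nonneg(1)) (auto simp: isCont_stieltjes_density stieltjes_density_nonneg)
  then show ?thesis
    by (simp add: set_integrable_def)
qed

section \<open>The residue theorem on a strip\<close>

text \<open>In the coordinate \<open>z = exp w\<close>, \<open>strip_fun s w dw\<close> is
  \<open>z powr (\<beta> - 1) / ((z powr \<beta> + c) * (z - s)) dz\<close>. The logarithmic
  coordinate replaces a keyhole contour around the cut by a rectangle, and no branch has to be
  chosen.\<close>

definition strip_fun :: "real \<Rightarrow> complex \<Rightarrow> complex" where
  "strip_fun s w = exp (of_real \<beta> * w) / (exp (of_real \<beta> * w) + of_real c) / (exp w - of_real s)"

text \<open>A zero would force \<open>\<beta> * Im w\<close> to be an odd multiple of
  \<open>pi\<close>, hence at least \<open>pi\<close> in modulus.\<close>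

lemma strip_exp_plus_const_nz:
  assumes "\<beta> * \<bar>Im w\<bar> < pi"
  shows "exp (of_real \<beta> * w) + of_real c \<noteq> 0"
proof
  assume "exp (of_real \<beta> * w) + of_real c = 0"
  then have "exp (of_real \<beta> * w) = exp (of_real (ln c) + \<i> * of_real pi)"
    using c by (simp add: exp_add exp_of_real eq_neg_iff_add_eq_0)
  then obtain n :: int where "of_real \<beta> * w = of_real (ln c) + \<i> * of_real pi + of_int (2 * n) * pi * \<i>"
    unfolding exp_eq by (auto simp: algebra_simps)
  then have n: "\<beta> * Im w = (2 * of_int n + 1) * pi"
    by (simp add: complex_eq_iff algebra_simps)
  have "\<bar>2 * real_of_int n + 1\<bar> \<ge> 1"
    by (cases "n \<ge> 0") linarith+
  then have "\<bar>2 * real_of_int n + 1\<bar> * pi \<ge> 1 * pi"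
    by (rule mult_right_mono) simp
  then have "\<beta> * \<bar>Im w\<bar> \<ge> pi"
    using n \<beta> by (metis abs_mult abs_of_pos mult_1 pi_gt_zero)
  with assms show False by simp
qed

text \<open>Solutions differ by multiples of the period \<open>2 * pi * \<i>\<close>, and the strip
  admits only the real one.\<close>

lemma strip_exp_eq_iff:
  assumes "\<bar>Im w\<bar> < 2 * pi" "s > 0"
  shows "exp w = of_real s \<longleftrightarrow> w = of_real (ln s)"
proof
  assume "exp w = of_real s"
  then have "exp w = exp (of_real (ln s))"
    using assms(2) by (simp add: exp_of_real)
  then obtain n :: int where n: "w = of_real (ln s) + of_int (2 * n) * pi * \<i>"
    unfolding exp_eq by (auto simp: algebra_simps)
  then have "Im w = 2 * of_int n * pi" by simp
  then have "\<bar>real_of_int n\<bar> * (2 * pi) < 1 * (2 * pi)"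
    using assms(1) by (simp add: abs_mult)
  then have "\<bar>real_of_int n\<bar> < 1"
    by (simp only: mult_less_cancel_right) auto
  then have "n = 0" by linarith
  then show "w = of_real (ln s)" using n by simp
qed (use assms in \<open>simp add: exp_of_real\<close>)

text \<open>The only singularity in the rectangle is the simple pole at \<open>ln s\<close>, and the
  bound on \<open>R\<close> places it in the interior.\<close>

lemma contour_integral_strip_fun:
  assumes s: "s > 0" and R: "R > \<bar>ln s\<bar>"
  shows "continuous_on (path_image (rectpath (Complex (-R) (-pi)) (Complex R pi))) (strip_fun s)"
    and "contour_integral (rectpath (Complex (-R) (-pi)) (Complex R pi)) (strip_fun s) =
      2 * pi * \<i> * of_real (s powr (\<beta> - 1) / (s powr \<beta> + c))"
proof -
  \<comment> \<open>\<open>d\<close> is the half-width of an open strip around the closed rectangle.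
    The bound \<open>2 * pi\<close> leaves a single pole of \<open>1 / (exp w - s)\<close>, the
    bound \<open>pi / \<beta>\<close> keeps the other denominator nonzero, and
    \<open>\<beta> < 1\<close> gives \<open>d > pi\<close>.\<close>
  define d where "d = min (2 * pi) (pi / \<beta>)"
  have d: "d > pi" "d \<le> 2 * pi" "\<beta> * d \<le> pi"
    using \<beta> by (auto simp: d_def min_def field_simps)
  define S where "S = {w. Im w < d} \<inter> {w. Im w > - d}"
  define z where "z = complex_of_real (ln s)"
  define G where "G w = exp (of_real \<beta> * w) / (exp (of_real \<beta> * w) + of_real c)" for w :: complex
  have S: "open S" "connected S"
    unfolding S_def
    by (auto intro!: open_Int open_halfspace_Im_lt open_halfspace_Im_gt convex_connected convex_Int
        convex_halfspace_Im_lt convex_halfspace_Im_gt)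
  have nz: "exp (of_real \<beta> * w) + of_real c \<noteq> 0" "exp w = of_real s \<longleftrightarrow> w = z" if "w \<in> S" for w
  proof -
    have w: "\<bar>Im w\<bar> < d" using that by (auto simp: S_def)
    then have "\<beta> * \<bar>Im w\<bar> < \<beta> * d" using \<beta> by simp
    then show "exp (of_real \<beta> * w) + of_real c \<noteq> 0"
      using d by (intro strip_exp_plus_const_nz) simp
    show "exp w = of_real s \<longleftrightarrow> w = z"
      using w d s by (simp add: strip_exp_eq_iff z_def)
  qed
  have zS: "z \<in> S" using d pi_gt_zero by (auto simp: S_def z_def)
  have holo: "strip_fun s holomorphic_on (S - {z})"
    unfolding strip_fun_def using nz by (auto intro!: holomorphic_intros)
  have zbox: "z \<in> box (Complex (-R) (-pi)) (Complex R pi)"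
    using R by (auto simp: in_box_complex_iff z_def)
  have Rpos: "R > 0" using R by simp
  have sub: "cbox (Complex (-R) (-pi)) (Complex R pi) \<subseteq> S"
    using d by (auto simp: in_cbox_complex_iff S_def)
  have image: "path_image (rectpath (Complex (-R) (-pi)) (Complex R pi)) \<subseteq> S - {z}"
    using sub zbox Rpos by (subst path_image_rectpath_cbox_minus_box) auto
  show "continuous_on (path_image (rectpath (Complex (-R) (-pi)) (Complex R pi))) (strip_fun s)"
    using image holo by (meson continuous_on_subset holomorphic_on_imp_continuous_on)
  have "residue (strip_fun s) z = G z / of_real s"
  proof (rule residue_simple'[OF S(1) zS holo])
    \<comment> \<open>The difference quotient of \<open>exp\<close> at \<open>z\<close> tends to
      \<open>exp z = s\<close>, so removing the pole leaves \<open>G z\<close> divided by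
      \<open>s\<close>.\<close>
    have "((\<lambda>w. (exp w - exp z) / (w - z)) \<longlongrightarrow> exp z) (at z)"
      using DERIV_exp[of z] by (simp add: has_field_derivative_iff)
    moreover have "exp z = of_real s" using s by (simp add: z_def exp_of_real)
    ultimately have "((\<lambda>w. (exp w - of_real s) / (w - z)) \<longlongrightarrow> of_real s) (at z)"
      by simp
    moreover have "isCont G z"
      unfolding G_def using nz(1)[OF zS] by (intro continuous_intros) auto
    then have "(G \<longlongrightarrow> G z) (at z)" by (simp add: isCont_def)
    ultimately have "((\<lambda>w. G w / ((exp w - of_real s) / (w - z))) \<longlongrightarrow> G z / of_real s) (at z)"
      using s by (intro tendsto_divide) auto
    then show "((\<lambda>w. strip_fun s w * (w - z)) \<longlongrightarrow> G z / of_real s) (at z)"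
      by (simp add: strip_fun_def G_def)
  qed
  moreover have "G z / of_real s = of_real (s powr (\<beta> - 1) / (s powr \<beta> + c))"
  proof -
    have "exp (of_real \<beta> * z) = complex_of_real (s powr \<beta>)"
      using s by (simp add: z_def powr_def flip: of_real_mult exp_of_real)
    then show ?thesis
      using s by (simp add: G_def powr_diff field_simps)
  qed
  moreover have "contour_integral (rectpath (Complex (-R) (-pi)) (Complex R pi)) (strip_fun s) =
      2 * pi * \<i> * (\<Sum>p\<in>{z}. winding_number (rectpath (Complex (-R) (-pi)) (Complex R pi)) p * residue (strip_fun s) p)"
  proof (rule Residue_theorem[OF S _ holo _ _ image])
    show "\<forall>w. w \<notin> S \<longrightarrow> winding_number (rectpath (Complex (-R) (-pi)) (Complex R pi)) w = 0"
      using sub Rpos by (auto intro!: winding_number_rectpath_outside)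
  qed auto
  ultimately show "contour_integral (rectpath (Complex (-R) (-pi)) (Complex R pi)) (strip_fun s) =
      2 * pi * \<i> * of_real (s powr (\<beta> - 1) / (s powr \<beta> + c))"
    using winding_number_rectpath[OF zbox] by simp
qed

text \<open>On both edges \<open>exp w\<close> equals \<open>- exp x\<close>, so the factor
  \<open>1 / (exp w - s)\<close> is the same. The other factor takes conjugate values, and their
  difference is an imaginary part, which gives the density.\<close>

lemma strip_fun_jump:
  assumes s: "s > 0"
  shows "strip_fun s (Complex x (-pi)) - strip_fun s (Complex x pi) =
    2 * pi * \<i> * of_real (stieltjes_density \<beta> c x / (exp x + s))"
proof -
  define e where "e = exp (\<beta> * x)"
  define S where "S = sin (\<beta> * pi)"
  define C where "C = cos (\<beta> * pi)"
  have D: "(e + c * C)\<^sup>2 + (c * S)\<^sup>2 > 0"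
    using stieltjes_density_denom_pos[of x] by (simp add: e_def S_def C_def)
  have CS: "C\<^sup>2 + S\<^sup>2 = 1" by (simp add: C_def S_def)
  have exp1: "exp (of_real \<beta> * Complex x pi) = of_real e * Complex C S"
    "exp (of_real \<beta> * Complex x (-pi)) = of_real e * Complex C (-S)"
    by (auto simp: e_def C_def S_def complex_eq_iff Re_exp Im_exp)
  have exp2: "exp (Complex x pi) = - of_real (exp x)" "exp (Complex x (-pi)) = - of_real (exp x)"
    by (auto simp: complex_eq_iff Re_exp Im_exp)
  have nz: "of_real e * Complex C S + of_real c \<noteq> 0" "of_real e * Complex C (-S) + of_real c \<noteq> 0"
    using strip_exp_plus_const_nz[of "Complex x pi"] strip_exp_plus_const_nz[of "Complex x (-pi)"] \<beta>
    by (auto simp: exp1)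
  \<comment> \<open>The two denominators are conjugate; \<open>C\<^sup>2 + S\<^sup>2 = 1\<close>
    brings their product into the form of the density's denominator.\<close>
  have prod: "(of_real e * Complex C S + of_real c) * (of_real e * Complex C (-S) + of_real c)
      = of_real ((e + c * C)\<^sup>2 + (c * S)\<^sup>2)"
  proof -
    have "(e + c * C)\<^sup>2 + (c * S)\<^sup>2 = (e * C + c)\<^sup>2 + (e * S)\<^sup>2"
      using CS by algebra
    then show ?thesis
      by (simp add: complex_eq_iff power2_eq_square algebra_simps)
  qed
  have "of_real e * Complex C S / (of_real e * Complex C S + of_real c) -
      of_real e * Complex C (-S) / (of_real e * Complex C (-S) + of_real c) =
      (of_real e * Complex C S * (of_real e * Complex C (-S) + of_real c) -
       of_real e * Complex C (-S) * (of_real e * Complex C S + of_real c)) /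
      of_real ((e + c * C)\<^sup>2 + (c * S)\<^sup>2)"
    using nz unfolding prod[symmetric] by (simp add: divide_simps)
  also have "of_real e * Complex C S * (of_real e * Complex C (-S) + of_real c) -
       of_real e * Complex C (-S) * (of_real e * Complex C S + of_real c) = 2 * \<i> * of_real (c * S * e)"
    by (simp add: complex_eq_iff algebra_simps)
  finally have jump: "of_real e * Complex C S / (of_real e * Complex C S + of_real c) -
      of_real e * Complex C (-S) / (of_real e * Complex C (-S) + of_real c) =
      2 * \<i> * of_real (c * S * e) / of_real ((e + c * C)\<^sup>2 + (c * S)\<^sup>2)" .
  have "- of_real (exp x) - of_real s = - complex_of_real (exp x + s)" by simp
  then have "strip_fun s (Complex x (-pi)) - strip_fun s (Complex x pi) =
     (of_real e * Complex C S / (of_real e * Complex C S + of_real c) -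
      of_real e * Complex C (-S) / (of_real e * Complex C (-S) + of_real c)) / of_real (exp x + s)"
    unfolding strip_fun_def exp1 exp2
    by (simp only: divide_minus_right) (simp add: diff_divide_distrib)
  also have "\<dots> = 2 * pi * \<i> * of_real (stieltjes_density \<beta> c x / (exp x + s))"
    unfolding jump stieltjes_density_def e_def[symmetric] S_def[symmetric] C_def[symmetric]
    by simp
  finally show ?thesis .
qed

text \<open>By the reverse triangle inequality. As \<open>R\<close> grows the first quotient tends
  to 1, and the decay comes from \<open>exp R - s\<close>.\<close>

lemma norm_strip_fun_right:
  assumes s: "s > 0" and R: "exp (\<beta> * R) > c" "exp R > s" and w: "Re w = R"
  shows "norm (strip_fun s w) \<le> exp (\<beta> * R) / (exp (\<beta> * R) - c) / (exp R - s)"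
proof -
  have n: "norm (exp (of_real \<beta> * w)) = exp (\<beta> * R)" "norm (exp w) = exp R"
    using w by simp_all
  have "exp (\<beta> * R) - c \<le> norm (exp (of_real \<beta> * w) + of_real c)"
    using norm_diff_ineq[of "exp (of_real \<beta> * w)" "of_real c"] n c by simp
  moreover have "exp R - s \<le> norm (exp w - of_real s)"
    using norm_triangle_ineq2[of "exp w" "of_real s"] n s by simp
  ultimately show ?thesis
    using R unfolding strip_fun_def norm_divide n
    by (intro frac_le) (auto intro!: divide_nonneg_nonneg)
qed

text \<open>On the far left the roles change: the last factor stays near \<open>1 / s\<close>, and
  the decay comes from the numerator \<open>exp (\<beta> * R)\<close>.\<close>

lemma norm_strip_fun_left:
  assumes s: "s > 0" and R: "exp (\<beta> * R) < c" "exp R < s" and w: "Re w = R"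
  shows "norm (strip_fun s w) \<le> exp (\<beta> * R) / (c - exp (\<beta> * R)) / (s - exp R)"
proof -
  have n: "norm (exp (of_real \<beta> * w)) = exp (\<beta> * R)" "norm (exp w) = exp R"
    using w by simp_all
  have "c - exp (\<beta> * R) \<le> norm (exp (of_real \<beta> * w) + of_real c)"
    using norm_diff_ineq[of "of_real c" "exp (of_real \<beta> * w)"] n c by (simp add: add.commute)
  moreover have "s - exp R \<le> norm (exp w - of_real s)"
    using norm_triangle_ineq2[of "of_real s" "exp w"] n s by (simp add: norm_minus_commute)
  ultimately show ?thesis
    using R unfolding strip_fun_def norm_divide n
    by (intro frac_le) (auto intro!: divide_nonneg_nonneg)
qed

end

section \<open>Evaluation of the Stieltjes transform\<close>

text \<open>The horizontal edges contribute the truncated integral through the jump, the residue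
  gives the right-hand side, and the vertical edges vanish as \<open>R\<close> grows.\<close>

lemma integral_stieltjes_density:
  assumes \<beta>: "0 < \<beta>" "\<beta> < 1" and c: "0 < c" and s: "0 < s"
  shows "(\<integral>x. stieltjes_density \<beta> c x / (exp x + s) \<partial>lborel) = s powr (\<beta> - 1) / (s powr \<beta> + c)"
proof -
  let ?k = "stieltjes_density \<beta> c"
  define F where "F = strip_fun \<beta> c s"
  define I where "I = s powr (\<beta> - 1) / (s powr \<beta> + c)"
  \<comment> \<open>The sum of the bounds on the right and left edges. Their length
    \<open>2 * pi\<close> cancels against the modulus of \<open>2 * pi * \<i>\<close> in the residue
    formula.\<close>
  define e where "e R = exp (\<beta> * R) / (exp (\<beta> * R) - c) / (exp R - s) +
    exp (\<beta> * (-R)) / (c - exp (\<beta> * (-R))) / (s - exp (-R))" for R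
  have cont: "continuous_on UNIV (\<lambda>x. ?k x / (exp x + s))"
    using isCont_stieltjes_density[OF \<beta> c] s
    by (intro continuous_intros) (auto simp: continuous_at_imp_continuous_on add_pos_pos less_imp_neq[symmetric])
  \<comment> \<open>Since \<open>exp x + s\<close> exceeds \<open>s\<close>, the integrand is
    dominated by the integrable \<open>?k x / s\<close>.\<close>
  have int: "integrable lborel (\<lambda>x. ?k x / (exp x + s))"
  proof (rule Bochner_Integration.integrable_bound)
    show "integrable lborel (\<lambda>x. ?k x / s)"
      using stieltjes_density_integrable[OF \<beta> c] by simp
    show "(\<lambda>x. ?k x / (exp x + s)) \<in> borel_measurable lborel"
      using borel_measurable_continuous_onI[OF cont] by simp
    show "AE x in lborel. norm (?k x / (exp x + s)) \<le> norm (?k x / s)"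
      using s by (intro AE_I2) (auto simp: abs_mult abs_divide add_pos_pos intro!: divide_left_mono mult_pos_pos)
  qed
  have "((\<lambda>R. integral {-R..R} (\<lambda>x. ?k x / (exp x + s))) \<longlongrightarrow> (\<integral>x. ?k x / (exp x + s) \<partial>lborel)) at_top"
    using has_integral_UNIV_imp_tendsto[OF has_integral_integral_lborel[OF int]] .
  moreover have "((\<lambda>R. integral {-R..R} (\<lambda>x. ?k x / (exp x + s))) \<longlongrightarrow> I) at_top"
  proof (rule LIM_zero_cancel, rule Lim_null_comparison)
    show "(e \<longlongrightarrow> 0) at_top"
    proof -
      have "((\<lambda>R. exp (\<beta> * R) / (exp (\<beta> * R) - c) / (exp R - s)) \<longlongrightarrow> 0) at_top"
        using \<beta> by real_asymp
      moreover have "((\<lambda>R. exp (\<beta> * (-R)) / (c - exp (\<beta> * (-R))) / (s - exp (-R))) \<longlongrightarrow> 0) at_top"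
        using \<beta> c s by real_asymp
      ultimately show ?thesis
        unfolding e_def[abs_def] by (rule tendsto_add_zero)
    qed
    have "\<forall>\<^sub>F R in at_top. exp (\<beta> * R) > c" "\<forall>\<^sub>F R in at_top. exp (\<beta> * (-R)) < c"
      "\<forall>\<^sub>F R in at_top. exp R > s" "\<forall>\<^sub>F R in at_top. exp (-R) < s"
      using \<beta> c s by real_asymp+
    then show "\<forall>\<^sub>F R in at_top. norm (integral {-R..R} (\<lambda>x. ?k x / (exp x + s)) - I) \<le> e R"
      using eventually_gt_at_top[of "\<bar>ln s\<bar>"]
    proof eventually_elim
      case (elim R)
      have "R > 0" using elim by simp
      define J where "J = integral {-R..R} (\<lambda>x. ?k x / (exp x + s))"
      note rect = contour_integral_strip_fun[OF \<beta> c s elim(5), folded F_def]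
      have contF: "continuous_on {-R..R} (\<lambda>x. F (Complex x y))" if "\<bar>y\<bar> = pi" for y
      proof (rule continuous_on_compose2[OF rect(1)])
        show "(\<lambda>x. Complex x y) ` {-R..R} \<subseteq> path_image (rectpath (Complex (-R) (-pi)) (Complex R pi))"
          using that \<open>R > 0\<close> by (subst path_image_rectpath) auto
      qed (auto simp: Complex_eq intro!: continuous_intros)
      have "integral {-R..R} (\<lambda>x. F (Complex x (-pi))) - integral {-R..R} (\<lambda>x. F (Complex x pi)) =
          integral {-R..R} (\<lambda>x. F (Complex x (-pi)) - F (Complex x pi))"
        by (subst Henstock_Kurzweil_Integration.integral_diff)
          (auto intro!: integrable_continuous_interval contF)
      also have "\<dots> = integral {-R..R} (\<lambda>x. 2 * pi * \<i> * of_real (?k x / (exp x + s)))"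
        unfolding F_def strip_fun_jump[OF \<beta> c s] ..
      also have "\<dots> = 2 * pi * \<i> * of_real J"
      proof (rule integral_unique, rule has_integral_mult_right, rule has_integral_of_real)
        show "((\<lambda>x. ?k x / (exp x + s)) has_integral J) {-R..R}"
          unfolding J_def
          by (intro integrable_integral integrable_continuous_interval continuous_on_subset[OF cont]) auto
      qed
      finally have jump: "integral {-R..R} (\<lambda>x. F (Complex x (-pi))) - integral {-R..R} (\<lambda>x. F (Complex x pi)) =
          2 * pi * \<i> * of_real J" .
      let ?V = "\<lambda>x. contour_integral (linepath (Complex x (-pi)) (Complex x pi)) F"
      have side: "norm (?V x) \<le> B * (2 * pi)"
        if x: "\<bar>x\<bar> = R" and B: "\<And>w. Re w = x \<Longrightarrow> norm (F w) \<le> B" for x B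
      proof -
        have seg: "Re w = x \<and> w \<in> path_image (rectpath (Complex (-R) (-pi)) (Complex R pi))"
          if w: "w \<in> closed_segment (Complex x (-pi)) (Complex x pi)" for w
        proof -
          have "Re w = x" "Im w \<in> {-pi..pi}"
            using w by (auto simp: closed_segment_same_Re closed_segment_eq_real_ivl)
          then show ?thesis
            using x \<open>R > 0\<close> by (subst path_image_rectpath) auto
        qed
        have "F contour_integrable_on linepath (Complex x (-pi)) (Complex x pi)"
          using seg by (intro contour_integrable_continuous_linepath continuous_on_subset[OF rect(1)]) auto
        then have "norm (?V x) \<le> B * norm (Complex x pi - Complex x (-pi))"
        proof (rule contour_integral_bound_linepath)
          show "B \<ge> 0"
            using norm_ge_zero B[of "Complex x 0"] by (metis complex.sel(1) order_trans)
        qed (use seg B in auto)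
        also have "Complex x pi - Complex x (-pi) = \<i> * of_real (2 * pi)"
          by (simp add: complex_eq_iff)
        also have "norm (\<i> * of_real (2 * pi)) = 2 * pi"
          by (simp only: norm_mult norm_ii norm_of_real) simp
        finally show ?thesis .
      qed
      have "2 * pi * \<i> * of_real I = 2 * pi * \<i> * of_real J + (?V R - ?V (-R))"
        using contour_integral_rectpath[OF rect(1)] \<open>R > 0\<close> rect(2) jump by (simp add: I_def)
      then have "2 * pi * \<i> * of_real (J - I) = ?V (-R) - ?V R"
        by (simp add: algebra_simps)
      then have "2 * pi * \<bar>J - I\<bar> = norm (?V (-R) - ?V R)"
        by (simp add: norm_mult flip: \<open>_ = ?V (-R) - ?V R\<close> del: of_real_diff)
      also have "\<dots> \<le> norm (?V (-R)) + norm (?V R)"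
        by (rule norm_triangle_ineq4)
      also have "\<dots> \<le> exp (\<beta> * (-R)) / (c - exp (\<beta> * (-R))) / (s - exp (-R)) * (2 * pi) +
          exp (\<beta> * R) / (exp (\<beta> * R) - c) / (exp R - s) * (2 * pi)"
        using \<open>R > 0\<close> elim unfolding F_def
        by (intro add_mono side[unfolded F_def] norm_strip_fun_left[OF \<beta> c s]
            norm_strip_fun_right[OF \<beta> c s]) auto
      also have "\<dots> = 2 * pi * e R"
        by (simp add: e_def algebra_simps)
      finally show ?case
        by (simp add: J_def)
    qed
  qed
  ultimately show ?thesis
    unfolding I_def using tendsto_unique trivial_limit_at_top_linorder by blast
qed

subsection \<open>Mixtures of exponentials\<close>

context
  fixes k :: "real \<Rightarrow> real"
  assumes k: "integrable lborel k" and k_nonneg: "\<And>x. k x \<ge> 0"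
begin

text \<open>Decay rates are written as \<open>exp x\<close>, so the weight lives on the whole line,
  in the coordinate along the horizontal edges of the rectangles.\<close>

definition exp_mixture :: "real \<Rightarrow> real" where
  "exp_mixture t = (\<integral>x. k x * exp (- exp x * t) \<partial>lborel)"

lemma exp_mixture_weight_measurable [measurable]: "k \<in> borel_measurable borel"
  using borel_measurable_integrable[OF k] by simp

text \<open>The majorant, independent of \<open>t\<close>, for both dominated convergence
  arguments.\<close>

lemma norm_exp_mixture_integrand_le:
  "t \<ge> 0 \<Longrightarrow> norm (k x * exp (- exp x * t)) \<le> k x"
  using k_nonneg[of x] by (simp add: abs_mult mult_left_le)

lemma continuous_on_exp_mixture: "continuous_on {0..} exp_mixture"
  unfolding continuous_on_sequentially
proof (intro allI ballI impI, elim conjE)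
  fix X :: "nat \<Rightarrow> real" and a assume X: "\<forall>n. X n \<in> {0..}" "X \<longlonglongrightarrow> a"
  show "(exp_mixture \<circ> X) \<longlonglongrightarrow> exp_mixture a"
    unfolding exp_mixture_def o_def
  proof (rule integral_dominated_convergence[OF _ _ k])
    show "AE x in lborel. (\<lambda>n. k x * exp (- exp x * X n)) \<longlonglongrightarrow> k x * exp (- exp x * a)"
      by (intro AE_I2 tendsto_intros X)
    show "AE x in lborel. norm (k x * exp (- exp x * X n)) \<le> k x" for n
      using X by (intro AE_I2 norm_exp_mixture_integrand_le) auto
  qed auto
qed

text \<open>Every rate \<open>exp x\<close> is positive, so the integrand tends to 0 pointwise and
  dominated convergence applies.\<close>

lemma exp_mixture_tendsto_0: "(exp_mixture \<longlongrightarrow> 0) at_top"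
proof -
  have "((\<lambda>t. \<integral>x. k x * exp (- exp x * t) \<partial>lborel) \<longlongrightarrow> (\<integral>x. 0 \<partial>(lborel :: real measure))) at_top"
  proof (rule integral_dominated_convergence_at_top[OF _ _ k])
    show "AE x in lborel. ((\<lambda>t. k x * exp (- exp x * t)) \<longlongrightarrow> 0) at_top"
    proof (intro AE_I2 tendsto_mult_right_zero)
      have "((\<lambda>t. exp (- a * t)) \<longlongrightarrow> 0) at_top" if "a > 0" for a :: real
        using that by real_asymp
      then show "((\<lambda>t. exp (- exp x * t)) \<longlongrightarrow> 0) at_top" for x :: real
        by simp
    qed
    show "\<forall>\<^sub>F t in at_top. AE x in lborel. norm (k x * exp (- exp x * t)) \<le> k x"
      using eventually_ge_at_top[of 0] by eventually_elim (intro AE_I2 norm_exp_mixture_integrand_le)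
  qed auto
  then show ?thesis by (simp add: exp_mixture_def[abs_def])
qed

text \<open>Fubini: the exponential of rate \<open>exp x\<close> has transform
  \<open>1 / (exp x + s)\<close>, which is then averaged against \<open>k\<close>.\<close>

lemma has_integral_laplace_exp_mixture:
  assumes s: "s > 0"
  shows "((\<lambda>t. exp (- s * t) * exp_mixture t) has_integral (\<integral>x. k x / (exp x + s) \<partial>lborel)) {0..}"
proof -
  \<comment> \<open>Cutting the exponential off to zero for negative \<open>t\<close> turns both
    integrals into integrals over the whole line, as needed for the product measure.\<close>
  define E where "E a t = indicator {0..} t * exp (- a * t)" for a t :: real
  have hbi: "has_bochner_integral lborel (E a) (1 / a)" if "a > 0" for a
  proof -
    have "((\<lambda>t. exp (- a * t)) has_integral 1 / a) {0..}"
      using has_integral_exp_minus_to_infinity[OF that, of 0] by simp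
    moreover have "E a = (\<lambda>t. if t \<in> {0..} then exp (- a * t) else 0)"
      by (simp add: E_def fun_eq_iff)
    ultimately have "(E a has_integral 1 / a) UNIV"
      unfolding \<open>E a = _\<close> has_integral_restrict_UNIV by blast
    moreover have E: "E a \<in> borel_measurable borel" "E a t \<ge> 0" for t
      by (simp_all add: E_def[abs_def])
    \<comment> \<open>Nonnegativity allows the passage from the gauge integral to the Lebesgue
      integral.\<close>
    ultimately have "(\<integral>\<^sup>+t. E a t \<partial>lborel) = ennreal (1 / a)"
      by (intro nn_integral_has_integral_lborel)
    with E that show ?thesis
      by (intro has_bochner_integral_nn_integral) auto
  qed
  define f where "f x t = k x * E (exp x + s) t" for x t
  have meas: "case_prod f \<in> borel_measurable (lborel \<Otimes>\<^sub>M lborel)"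
    unfolding f_def E_def by measurable
  have le: "norm (f x t) \<le> k x * E s t" for x t
    using k_nonneg[of x] unfolding f_def E_def
    by (auto simp: indicator_def abs_mult left_diff_distrib intro!: mult_left_mono)
  \<comment> \<open>Dropping \<open>exp x\<close> from the rate gives a majorant that is a product
    of a function of \<open>x\<close> and a function of \<open>t\<close>.\<close>
  have int: "integrable (lborel \<Otimes>\<^sub>M lborel) (case_prod f)"
  proof (rule Bochner_Integration.integrable_bound)
    show "integrable (lborel \<Otimes>\<^sub>M lborel) (\<lambda>(x, t). k x * E s t)"
    proof (rule lborel_pair.Fubini_integrable)
      show "(\<lambda>(x, t). k x * E s t) \<in> borel_measurable (lborel \<Otimes>\<^sub>M lborel)"
        unfolding E_def by measurable
      show "AE x in lborel. integrable lborel (\<lambda>t. (case (x, t) of (x, t) \<Rightarrow> k x * E s t))"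
        using hbi[OF s] by (auto simp: has_bochner_integral_iff)
      have "norm (k x * E s t) = k x * E s t" for x t
        using k_nonneg[of x] by (simp add: E_def)
      then show "integrable lborel (\<lambda>x. \<integral>t. norm (case (x, t) of (x, t) \<Rightarrow> k x * E s t) \<partial>lborel)"
        using k by simp
    qed
    show "AE z in lborel \<Otimes>\<^sub>M lborel. norm (case_prod f z) \<le> norm (case z of (x, t) \<Rightarrow> k x * E s t)"
      using order_trans[OF le abs_ge_self] by (intro AE_I2) (simp add: split_beta)
  qed (rule meas)
  have "(\<integral>x. f x t \<partial>lborel) = (if t \<in> {0..} then exp (- s * t) * exp_mixture t else 0)" for t
  proof -
    have "f x t = indicator {0..} t * exp (- s * t) * (k x * exp (- exp x * t))" for x
      unfolding f_def E_def by (simp add: algebra_simps flip: exp_add)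
    then have "(\<integral>x. f x t \<partial>lborel) = indicator {0..} t * exp (- s * t) * exp_mixture t"
      by (simp add: exp_mixture_def)
    then show ?thesis by simp
  qed
  moreover have "(\<integral>t. f x t \<partial>lborel) = k x / (exp x + s)" for x
    using hbi[of "exp x + s"] s unfolding f_def
    by (simp add: has_bochner_integral_iff add_pos_pos)
  moreover have "integrable lborel (\<lambda>t. \<integral>x. f x t \<partial>lborel)"
    using lborel_pair.integrable_snd[OF int] .
  from has_integral_integral_lborel[OF this]
  have "((\<lambda>t. \<integral>x. f x t \<partial>lborel) has_integral (\<integral>t. (\<integral>x. f x t \<partial>lborel) \<partial>lborel)) UNIV" .
  ultimately have "((\<lambda>t. if t \<in> {0..} then exp (- s * t) * exp_mixture t else 0) has_integral
      (\<integral>x. k x / (exp x + s) \<partial>lborel)) UNIV"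
    using lborel_pair.Fubini_integral[OF int] by simp
  then show ?thesis
    by (simp only: has_integral_restrict_UNIV)
qed

end

section \<open>The Mittag-Leffler relaxation function and the limit\<close>

text \<open>For \<open>\<beta> = 1\<close> the function is a single exponential of rate
  \<open>c\<close>, which no integrable density represents; for \<open>\<beta> < 1\<close> the
  mixture with the Stieltjes density serves.\<close>

lemma mittag_leffler_relaxation:
  fixes \<beta> c :: real
  assumes "0 < \<beta>" "\<beta> \<le> 1" "0 < c"
  obtains g where "continuous_on {0..} g" "(g \<longlongrightarrow> 0) at_top"
    "\<And>s. s > 0 \<Longrightarrow> ((\<lambda>t. exp (- s * t) * g t) has_integral s powr (\<beta> - 1) / (s powr \<beta> + c)) {0..}"
proof (cases "\<beta> = 1")
  case True
  show ?thesis
  proof (rule that)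
    show "continuous_on {0..} (\<lambda>t. exp (- c * t))"
      by (intro continuous_intros)
    show "((\<lambda>t. exp (- c * t)) \<longlongrightarrow> 0) at_top"
      using assms(3) by real_asymp
    fix s :: real assume "s > 0"
    then have "((\<lambda>t. exp (- (s + c) * t)) has_integral 1 / (s + c)) {0..}"
      using has_integral_exp_minus_to_infinity[of "s + c" 0] assms(3) by simp
    moreover have "exp (- (s + c) * t) = exp (- s * t) * exp (- c * t)" for t
      by (simp add: algebra_simps flip: exp_add)
    ultimately show "((\<lambda>t. exp (- s * t) * exp (- c * t)) has_integral s powr (\<beta> - 1) / (s powr \<beta> + c)) {0..}"
      using True \<open>s > 0\<close> by simp
  qed
next
  case False
  then have \<beta>: "0 < \<beta>" "\<beta> < 1" using assms by auto
  note dens = stieltjes_density_integrable[OF \<beta> assms(3)] stieltjes_density_nonneg[OF \<beta> assms(3)]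
  show ?thesis
  proof (rule that)
    show "continuous_on {0..} (exp_mixture (stieltjes_density \<beta> c))"
      by (rule continuous_on_exp_mixture[OF dens])
    show "(exp_mixture (stieltjes_density \<beta> c) \<longlongrightarrow> 0) at_top"
      by (rule exp_mixture_tendsto_0[OF dens])
    fix s :: real assume "s > 0"
    from has_integral_laplace_exp_mixture[OF dens this]
    show "((\<lambda>t. exp (- s * t) * exp_mixture (stieltjes_density \<beta> c) t) has_integral
        s powr (\<beta> - 1) / (s powr \<beta> + c)) {0..}"
      unfolding integral_stieltjes_density[OF \<beta> assms(3) \<open>s > 0\<close>] .
  qed
qed

theorem proposition3:
  fixes \<Lambda>0 \<alpha> \<gamma> \<beta> :: real and lam :: "real \<Rightarrow> real"
  assumes "\<Lambda>0 > 0"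
    and "0 < \<alpha>" and "\<alpha> < 1"
    and "\<gamma> > 0"
    and "0 < \<beta>" and "\<beta> \<le> 1"
    and "lam = inverse_laplace
           (\<lambda>s. \<Lambda>0 / s * ((\<gamma> + s powr \<beta>) / ((1 - \<alpha>) * \<gamma> + s powr \<beta>)))"
  shows "(lam \<longlongrightarrow> \<Lambda>0 / (1 - \<alpha>)) at_top"
proof -
  define c where "c = (1 - \<alpha>) * \<gamma>"
  have "c > 0" using assms by (simp add: c_def)
  obtain g where g: "continuous_on {0..} g" "(g \<longlongrightarrow> 0) at_top"
    and laplace_g: "\<And>s. s > 0 \<Longrightarrow>
      ((\<lambda>t. exp (- s * t) * g t) has_integral s powr (\<beta> - 1) / (s powr \<beta> + c)) {0..}"
    using mittag_leffler_relaxation[OF assms(5,6) \<open>c > 0\<close>] by blast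
  \<comment> \<open>With \<open>p = s powr \<beta>\<close>, the identity
    \<open>(1 - \<alpha>) * (\<gamma> + p) = (p + c) - \<alpha> * p\<close> splits the given
    transform into a constant part and a multiple of the transform of \<open>g\<close>. The value 0
    for negative \<open>t\<close> is the normalisation in \<open>inverse_laplace\<close>.\<close>
  define f where "f t = (if t < 0 then 0 else \<Lambda>0 / (1 - \<alpha>) * (1 - \<alpha> * g t))" for t
  have "lam = f"
    unfolding assms(7)
  proof (rule inverse_laplace_eqI)
    have "continuous_on {0..} (\<lambda>t. \<Lambda>0 / (1 - \<alpha>) * (1 - \<alpha> * g t))"
      by (intro continuous_intros g)
    then show "continuous_on {0..} f"
      by (rule continuous_on_eq) (auto simp: f_def)
    show "f t = 0" if "t < 0" for t
      using that by (simp add: f_def)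
    show "\<forall>\<^sub>F s in at_top. ((\<lambda>t. exp (- s * t) * f t) has_integral
        \<Lambda>0 / s * ((\<gamma> + s powr \<beta>) / ((1 - \<alpha>) * \<gamma> + s powr \<beta>))) {0..}"
      using eventually_gt_at_top[of 0]
    proof eventually_elim
      case (elim s)
      let ?G = "s powr (\<beta> - 1) / (s powr \<beta> + c)"
      have "((\<lambda>t. exp (- s * t)) has_integral 1 / s) {0..}"
        using has_integral_exp_minus_to_infinity[OF elim, of 0] by simp
      then have "((\<lambda>t. \<Lambda>0 / (1 - \<alpha>) * (exp (- s * t) - \<alpha> * (exp (- s * t) * g t))) has_integral
          \<Lambda>0 / (1 - \<alpha>) * (1 / s - \<alpha> * ?G)) {0..}"
        by (intro has_integral_mult_right has_integral_diff laplace_g elim)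
      then have "((\<lambda>t. exp (- s * t) * f t) has_integral \<Lambda>0 / (1 - \<alpha>) * (1 / s - \<alpha> * ?G)) {0..}"
        by (rule has_integral_eq[rotated]) (auto simp: f_def algebra_simps)
      moreover have "\<Lambda>0 / (1 - \<alpha>) * (1 / s - \<alpha> * ?G) =
          \<Lambda>0 / s * ((\<gamma> + s powr \<beta>) / ((1 - \<alpha>) * \<gamma> + s powr \<beta>))"
      proof -
        define p where "p = s powr \<beta>"
        have p: "p > 0" "s powr (\<beta> - 1) = p / s"
          using elim by (auto simp: p_def powr_diff)
        have "1 / s - \<alpha> * ?G = ((1 - \<alpha>) * (\<gamma> + p)) / (s * (p + c))"
          using elim p(1) \<open>c > 0\<close> unfolding p(2) p_def[symmetric]
          by (simp add: divide_simps) (simp add: c_def algebra_simps)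
        then show ?thesis
          using assms(3) unfolding p_def[symmetric] c_def[symmetric] by (simp add: add.commute)
      qed
      ultimately show ?case by simp
    qed
  qed
  moreover have "(f \<longlongrightarrow> \<Lambda>0 / (1 - \<alpha>)) at_top"
  proof -
    have "((\<lambda>t. \<Lambda>0 / (1 - \<alpha>) * (1 - \<alpha> * g t)) \<longlongrightarrow> \<Lambda>0 / (1 - \<alpha>) * (1 - \<alpha> * 0)) at_top"
      by (intro tendsto_intros g)
    moreover have "\<forall>\<^sub>F t in at_top. \<Lambda>0 / (1 - \<alpha>) * (1 - \<alpha> * g t) = f t"
      using eventually_ge_at_top[of 0] by eventually_elim (simp add: f_def)
    ultimately show ?thesis by (simp add: filterlim_cong)
  qed
  ultimately show ?thesis by simp
qed

end
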